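(* Let $C$ be a finitely generated, strongly connected extended Choquet cone. Let $X\subseteq C$, the space $V_C$ of $\mathbb{R}$-valued functions on $X$, and the set $V_C^+$ of positive functions be as defined in the context. Then the pair $(V_C,V_C^+)$ is an ordered vector space having the Riesz interpolation property.
   Context: A cone is an abelian monoid $(C,+)$ with a scalar multiplication $(0,\infty)\times C\to C$ that is additive in each variable and satisfies $s(tx)=(st)x$ and $1\cdot x=x$ (cancellation is not assumed). The algebraic preorder: $x\le y$ iff $x+z=y$ for some $z\in C$; $C$ is algebraically ordered if this is a partial order. A topological cone has a topology making addition and scalar multiplication $(0,\infty)\times C\to C$ jointly continuous. An extended Choquet cone is an algebraically ordered topological cone $C$ that is a lattice under the algebraic order with addition distributing over $\wedge$ and $\vee$, and whose topology is compact, Hausdorff and locally convex (has a basis of open convex sets). Such cones are complete lattices. $\mathrm{Idem}(C)=\{w\in C:2w=w\}$. For $x\in C$, $\epsilon(x)$ denotes the support idempotent of $x$: the maximum of $\{z\in C:x+z=x\}$ (it exists and is idempotent). For $w\in\mathrm{Idem}(C)$, $C_w=\{x\in C:\epsilon(x)=w\}$, a cancellative cone with zero element $w$. $C$ is strongly connected if $\{x\in C:x\le w\}$ is connected for every $w\in\mathrm{Idem}(C)$. $C$ is finitely generated if there is a finite set $Z\subseteq C$ such that every $x\in C$ is of the form $\sum_{i=1}^n\alpha_iz_i$ with $\alpha_i\in(0,\infty)$, $z_i\in Z$. Construction of $X$. For $w\in \mathrm{Idem}(C)$ and $x\in C_w$, an extension of $x$ is $z\in C$ with $z+w=x$; there is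 a minimum extension $\tilde x=\inf\{z\in C:z+w=x\}$, which is itself an extension of $x$. An element $x\in C_w\setminus\{w\}$ generates an extreme ray of $C_w$ if $x=y+z$ with $y,z\in C_w$ implies that each of $y,z$ is $w$ or a positive multiple of $x$. Let $X_w$ be the set of minimum extensions of all elements $x\in C_w\setminus\{w\}$ generating an extreme ray of $C_w$. The set $\bigcup_{w\in\mathrm{Idem}(C)}X_w$ is closed under multiplication by positive scalars; $X$ is obtained by choosing one representative from each ray in this union. For $w\in\mathrm{Idem}(C)$ let $O_w=\{x\in X:x\nleq w\}$ and $P_w=\{x\in O_w:\epsilon(x)\le w\}$. A function $f\colon X\to\mathbb{R}$ is positive if there exists $w\in\mathrm{Idem}(C)$ such that $f(x)=0$ for $x\in X\setminus O_w$ and $f(x)>0$ for $x\in P_w$. $V_C$ is the vector space of all functions $X\to\mathbb{R}$ and $V_C^+$ its set of positive functions. $(V,V^+)$ is an ordered vector space if $V^+$ is closed under addition and positive scalars, $V=V^+-V^+$, and $V^+\cap(-V^+)=\{0\}$; the order is $f\le g$ iff $g-f\in V^+$. Riesz interpolation property: if $a_i\le b_j$ for $i,j\in\{1,2\}$, there is $c$ with $a_i\le c\le b_j$ for all $i,j$. *)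

theory Defs
  imports "HOL-Analysis.Analysis" "HOL-Library.Function_Algebras"
begin

text \<open>
  A cone is a whole type. Only scalars in \<open>(0,\<infinity>)\<close> act: nothing is assumed about
  \<open>r *\<^sub>R x\<close> for \<open>r \<le> 0\<close>, and no statement below uses such a product.
\<close>

class cone = comm_monoid_add + scaleR +
  assumes cone_scaleR_add_right: "0 < t \<Longrightarrow> t *\<^sub>R (x + y) = t *\<^sub>R x + t *\<^sub>R y"
    and cone_scaleR_add_left: "0 < s \<Longrightarrow> 0 < t \<Longrightarrow> (s + t) *\<^sub>R x = s *\<^sub>R x + t *\<^sub>R x"
    and cone_scaleR_scaleR: "0 < s \<Longrightarrow> 0 < t \<Longrightarrow> s *\<^sub>R (t *\<^sub>R x) = (s * t) *\<^sub>R x"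
    and cone_scaleR_one: "1 *\<^sub>R x = x"

text \<open>
  The library's \<^const>\<open>convex\<close> requires a real vector space.
\<close>

definition (in cone) cone_convex :: "'a set \<Rightarrow> bool" where
  "cone_convex S \<longleftrightarrow>
     (\<forall>x\<in>S. \<forall>y\<in>S. \<forall>t. 0 < t \<and> t < 1 \<longrightarrow> t *\<^sub>R x + (1 - t) *\<^sub>R y \<in> S)"

text \<open>
  Joint continuity of addition is part of \<^class>\<open>topological_comm_monoid_add\<close>.
  The second assumption is joint continuity of \<open>(0,\<infinity>) \<times> C \<rightarrow> C\<close> at each point \<open>(t, x)\<close>;
  as \<open>(0,\<infinity>)\<close> is open, neighbourhoods of \<open>t\<close> may be taken in the reals.
\<close>

class topological_cone = cone + topological_comm_monoid_add +
  assumes tendsto_scaleR_Pair: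
    "0 < t \<Longrightarrow> filterlim (\<lambda>p. fst p *\<^sub>R snd p) (nhds (t *\<^sub>R x)) (nhds t \<times>\<^sub>F nhds x)"

text \<open>
  \<^class>\<open>canonically_ordered_monoid_add\<close> says that \<open>\<le>\<close> is a partial order and that
  \<open>x \<le> y\<close> iff \<open>y = x + z\<close> for some \<open>z\<close>. So \<open>\<le>\<close>, and with it \<^const>\<open>inf\<close> and
  \<^const>\<open>sup\<close>, are determined by the addition.
\<close>

class extended_choquet_cone =
  topological_cone + canonically_ordered_monoid_add + lattice + t2_space +
  assumes add_inf_distrib: "x + inf y z = inf (x + y) (x + z)"
    and add_sup_distrib: "x + sup y z = sup (x + y) (x + z)"
    and compact_cone: "compact UNIV"
    and locally_convex_cone: "\<exists>B. topological_basis B \<and> (\<forall>U\<in>B. cone_convex U)"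

definition Idem :: "'a::cone set" where
  "Idem = {w. 2 *\<^sub>R w = w}"

definition support_idem :: "'a::extended_choquet_cone \<Rightarrow> 'a" where
  "support_idem x = (GREATEST z. x + z = x)"

definition cone_at :: "'a::extended_choquet_cone \<Rightarrow> 'a set" where
  "cone_at w = {x. support_idem x = w}"

definition strongly_connected :: "'a::extended_choquet_cone itself \<Rightarrow> bool" where
  "strongly_connected TYPE('a) \<longleftrightarrow> (\<forall>w::'a. w \<in> Idem \<longrightarrow> connected {x. x \<le> w})"

definition finitely_generated :: "'a::cone itself \<Rightarrow> bool" where
  "finitely_generated TYPE('a) \<longleftrightarrow>
     (\<exists>Z::'a set. finite Z \<and>
        (\<forall>x. \<exists>(n::nat) (\<alpha>::nat \<Rightarrow> real) z.
           (\<forall>i\<in>{1..n}. 0 < \<alpha> i \<and> z i \<in> Z) \<and> x = (\<Sum>i=1..n. \<alpha> i *\<^sub>R z i)))"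

text \<open>
  The infimum in \<open>'a\<close>, which is a complete lattice although its class only provides
  binary \<^const>\<open>inf\<close>.
\<close>

definition min_extension :: "'a::extended_choquet_cone \<Rightarrow> 'a \<Rightarrow> 'a" where
  "min_extension w x = (GREATEST l. \<forall>z\<in>{z. z + w = x}. l \<le> z)"

definition generates_extreme_ray :: "'a::extended_choquet_cone \<Rightarrow> 'a \<Rightarrow> bool" where
  "generates_extreme_ray w x \<longleftrightarrow>
     x \<in> cone_at w - {w} \<and>
     (\<forall>y\<in>cone_at w. \<forall>z\<in>cone_at w. x = y + z \<longrightarrow>
        (y = w \<or> (\<exists>t>0. y = t *\<^sub>R x)) \<and> (z = w \<or> (\<exists>t>0. z = t *\<^sub>R x)))"

definition extreme_extensions_at :: "'a::extended_choquet_cone \<Rightarrow> 'a set" where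
  "extreme_extensions_at w = min_extension w ` {x. generates_extreme_ray w x}"

definition extreme_extensions :: "'a::extended_choquet_cone set" where
  "extreme_extensions = (\<Union>w\<in>Idem. extreme_extensions_at w)"

definition ray_representatives :: "'a::cone set \<Rightarrow> 'a set \<Rightarrow> bool" where
  "ray_representatives U X \<longleftrightarrow> X \<subseteq> U \<and> (\<forall>u\<in>U. \<exists>!x. x \<in> X \<and> (\<exists>t>0. x = t *\<^sub>R u))"

instantiation "fun" :: (type, real_vector) real_vector
begin

definition scaleR_fun :: "real \<Rightarrow> ('a \<Rightarrow> 'b) \<Rightarrow> 'a \<Rightarrow> 'b" where
  "scaleR_fun r f = (\<lambda>x. r *\<^sub>R f x)"

instance
  by standard (simp_all add: scaleR_fun_def plus_fun_def fun_eq_iff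
      scaleR_add_right scaleR_add_left)

end

definition ordered_vector_space :: "'v::real_vector set \<Rightarrow> 'v set \<Rightarrow> bool" where
  "ordered_vector_space V P \<longleftrightarrow>
     subspace V \<and> P \<subseteq> V \<and>
     (\<forall>f\<in>P. \<forall>g\<in>P. f + g \<in> P) \<and>
     (\<forall>t>0. \<forall>f\<in>P. t *\<^sub>R f \<in> P) \<and>
     V = {f - g | f g. f \<in> P \<and> g \<in> P} \<and>
     P \<inter> uminus ` P = {0}"

definition riesz_interpolation :: "'v::real_vector set \<Rightarrow> 'v set \<Rightarrow> bool" where
  "riesz_interpolation V P \<longleftrightarrow>
     (let le = (\<lambda>f g. g - f \<in> P) in
      \<forall>a b :: nat \<Rightarrow> 'v.
        (\<forall>i\<in>{1,2}. a i \<in> V \<and> b i \<in> V) \<and> (\<forall>i\<in>{1,2}. \<forall>j\<in>{1,2}. le (a i) (b j)) \<longrightarrow>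
        (\<exists>c\<in>V. \<forall>i\<in>{1,2}. \<forall>j\<in>{1,2}. le (a i) c \<and> le c (b j)))"

text \<open>
  A function \<open>X \<rightarrow> \<real>\<close> is represented by its extension by zero to the whole type,
  so that the vector space operations and equality are those of \<open>X \<rightarrow> \<real>\<close>.
\<close>

definition function_space :: "'a set \<Rightarrow> ('a \<Rightarrow> real) set" where
  "function_space X = {f. \<forall>x. x \<notin> X \<longrightarrow> f x = 0}"

definition O_set :: "'a::extended_choquet_cone set \<Rightarrow> 'a \<Rightarrow> 'a set" where
  "O_set X w = {x \<in> X. \<not> x \<le> w}"

definition P_set :: "'a::extended_choquet_cone set \<Rightarrow> 'a \<Rightarrow> 'a set" where
  "P_set X w = {x \<in> O_set X w. support_idem x \<le> w}"

definition positive_functions :: "'a::extended_choquet_cone set \<Rightarrow> ('a \<Rightarrow> real) set" where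
  "positive_functions X =
     {f \<in> function_space X.
        \<exists>w\<in>Idem. (\<forall>x\<in>X - O_set X w. f x = 0) \<and> (\<forall>x\<in>P_set X w. 0 < f x)}"

end

theory Submission
  imports Defs
begin

text \<open>
  For idempotents \<open>w < v\<close>, finite generation and strong connectedness give an element
  of \<open>X\<close> below \<open>v\<close> that lies in \<open>P\<^sub>w\<close>. Hence the idempotent witnessing the
  positivity of a function is unique, and since \<open>0\<close> is positive at the top element, only
  \<open>0\<close> is both positive and negative.

  For interpolation let \<open>b\<^sub>j - a\<^sub>i\<close> be positive at \<open>w\<^sub>i\<^sub>j\<close>. Uniqueness,
  applied to \<open>(b\<^sub>1 - a\<^sub>1) + (b\<^sub>2 - a\<^sub>2) = (b\<^sub>2 - a\<^sub>1) + (b\<^sub>1 - a\<^sub>2)\<close>, gives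
  \<open>w\<^sub>1\<^sub>1 \<and> w\<^sub>2\<^sub>2 = w\<^sub>1\<^sub>2 \<and> w\<^sub>2\<^sub>1\<close>. One then looks for \<open>c\<close> with \<open>c - a\<^sub>i\<close> positive at
  \<open>u\<^sub>i = w\<^sub>i\<^sub>1 + w\<^sub>i\<^sub>2\<close> and \<open>b\<^sub>j - c\<close> positive at \<open>v\<^sub>j = w\<^sub>1\<^sub>j + w\<^sub>2\<^sub>j\<close>. The resulting
  constraints on each value \<open>c x\<close> are consistent because a minimum extension of an
  extreme ray lying below a sum of two idempotents lies below one of them.
\<close>

section \<open>The order and the topology\<close>

text \<open>Directedness puts a single nonempty member of the family inside every finite
  intersection, so the finite intersection property applies. The top element, support idempotents
  and minimum extensions below are all points of such intersections.\<close>

lemma compact_directed_Inter: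
  assumes "compact (UNIV :: 'b::topological_space set)" and "I \<noteq> {}"
    and closed: "\<And>i. i \<in> I \<Longrightarrow> closed (A i :: 'b set)"
    and nonempty: "\<And>i. i \<in> I \<Longrightarrow> A i \<noteq> {}"
    and directed: "\<And>i j. i \<in> I \<Longrightarrow> j \<in> I \<Longrightarrow> \<exists>k\<in>I. A k \<subseteq> A i \<inter> A j"
  shows "(\<Inter>i\<in>I. A i) \<noteq> {}"
proof -
  have below: "\<exists>k\<in>I. A k \<subseteq> \<Inter>(A ` J)" if "finite J" "J \<subseteq> I" for J
    using that
  proof (induction J rule: finite_induct)
    case empty
    then show ?case using \<open>I \<noteq> {}\<close> by auto
  next
    case (insert j J)
    then obtain k where "k \<in> I" "A k \<subseteq> \<Inter>(A ` J)" by auto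
    moreover from this insert.prems obtain l where "l \<in> I" "A l \<subseteq> A j \<inter> A k"
      using directed by (meson insert_subset)
    ultimately show ?case by auto
  qed
  have "UNIV \<inter> \<Inter>(A ` I) \<noteq> {}"
  proof (rule compact_imp_fip)
    fix F assume "finite F" "F \<subseteq> A ` I"
    then obtain J where "finite J" "J \<subseteq> I" "F = A ` J"
      by (meson finite_subset_image)
    then show "UNIV \<inter> \<Inter>F \<noteq> {}"
      using below nonempty by fastforce
  qed (use assms in auto)
  then show ?thesis by simp
qed

declare cone_scaleR_one [simp]

lemma scaleR_mono:
  fixes x y :: "'a::extended_choquet_cone"
  assumes "0 < t" "x \<le> y"
  shows "t *\<^sub>R x \<le> t *\<^sub>R y"
  using assms cone_scaleR_add_right by (metis le_iff_add)

lemma le_add_left [simp]: "(x::'a::extended_choquet_cone) \<le> x + y"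
  and le_add_right [simp]: "(x::'a::extended_choquet_cone) \<le> y + x"
  by (auto simp: le_iff_add ac_simps)

lemma scaleR_le_scaleR:
  fixes x :: "'a::extended_choquet_cone"
  assumes "0 < s" "s \<le> t"
  shows "s *\<^sub>R x \<le> t *\<^sub>R x"
proof (cases "s = t")
  case False
  then have "t *\<^sub>R x = s *\<^sub>R x + (t - s) *\<^sub>R x"
    using assms cone_scaleR_add_left[of s "t - s" x] by simp
  then show ?thesis by simp
qed simp

lemma scaleR_inverse_cancel:
  fixes x :: "'a::extended_choquet_cone"
  assumes "0 < t"
  shows "(1 / t) *\<^sub>R (t *\<^sub>R x) = x" "t *\<^sub>R ((1 / t) *\<^sub>R x) = x"
  using assms by (simp_all add: cone_scaleR_scaleR)

text \<open>For the algebraic order an up-set is the image of the compact cone under a translation,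
  and compact sets are closed in a Hausdorff space.\<close>

lemma closed_atLeast_cone: "closed {y :: 'a::extended_choquet_cone. a \<le> y}"
proof -
  have "{y. a \<le> y} = range (\<lambda>c. a + c)" by (auto simp: le_iff_add)
  moreover have "compact (range (\<lambda>c. a + c))"
    by (intro compact_continuous_image compact_cone continuous_on_add continuous_on_id
        continuous_on_const)
  ultimately show ?thesis by (simp add: compact_imp_closed)
qed

text \<open>A down-set is the first projection of the closed, hence compact, set of pairs with sum
  \<open>b\<close>.\<close>

lemma closed_atMost_cone: "closed {y :: 'a::extended_choquet_cone. y \<le> b}"
proof -
  let ?P = "{p :: 'a \<times> 'a. fst p + snd p = b}"
  have "closed ?P"
    by (intro closed_Collect_eq continuous_on_add continuous_on_fst continuous_on_snd
        continuous_on_id continuous_on_const)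
  moreover have "compact (UNIV :: ('a \<times> 'a) set)"
    using compact_Times[OF compact_cone compact_cone] by simp
  ultimately have "compact ?P"
    using compact_Int_closed by fastforce
  then have "compact (fst ` ?P)"
    by (intro compact_continuous_image continuous_on_fst continuous_on_id)
  moreover have "fst ` ?P = {y. y \<le> b}" by (force simp: le_iff_add image_iff)
  ultimately show ?thesis by (simp add: compact_imp_closed)
qed

lemma cone_top_exists: "\<exists>T :: 'a::extended_choquet_cone. \<forall>x. x \<le> T"
proof -
  have "(\<Inter>x. {y :: 'a. x \<le> y}) \<noteq> {}"
  proof (rule compact_directed_Inter[OF compact_cone])
    fix i j :: 'a
    show "\<exists>k\<in>UNIV. {y. k \<le> y} \<subseteq> {y. i \<le> y} \<inter> {y. j \<le> y}"
      by (rule bexI[of _ "sup i j"]) auto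
  qed (auto intro: closed_atLeast_cone)
  then show ?thesis by auto
qed

section \<open>Idempotents\<close>

lemma Idem_iff_add: "w \<in> Idem \<longleftrightarrow> w + w = (w :: 'a::extended_choquet_cone)"
  using cone_scaleR_add_left[of 1 1 w] by (simp add: Idem_def)

text \<open>Natural multiples fix \<open>w\<close>, so monotonicity in the scalar gives
  \<open>s *\<^sub>R w \<le> w\<close> for every positive \<open>s\<close>. The case
  \<open>1 / t\<close>, scaled by \<open>t\<close>, is the reverse inequality.\<close>

lemma Idem_scaleR:
  fixes w :: "'a::extended_choquet_cone"
  assumes "w \<in> Idem" "0 < t"
  shows "t *\<^sub>R w = w"
proof -
  have nat: "real (Suc n) *\<^sub>R w = w" for n
  proof (induction n)
    case (Suc n)
    have "real (Suc (Suc n)) *\<^sub>R w = real (Suc n) *\<^sub>R w + 1 *\<^sub>R w"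
      using cone_scaleR_add_left[of "real (Suc n)" 1 w] by (simp add: add.commute)
    then show ?case using Suc assms by (simp add: Idem_iff_add)
  qed simp
  have le: "s *\<^sub>R w \<le> w" if "0 < s" for s
  proof -
    obtain n where "s \<le> real (Suc n)"
      by (meson less_imp_le lessI of_nat_less_iff order_trans real_arch_simple)
    then show ?thesis using scaleR_le_scaleR[OF that, of _ w] nat by metis
  qed
  have "(1 / t) *\<^sub>R w \<le> w" using le assms by simp
  then have "w \<le> t *\<^sub>R w"
    using scaleR_mono[of t] scaleR_inverse_cancel[of t w] assms by metis
  with le[OF assms(2)] show ?thesis by simp
qed

lemma Idem_add_absorb:
  fixes w :: "'a::extended_choquet_cone"
  assumes "w \<in> Idem"
  shows "x \<le> w \<Longrightarrow> w + x = w" and "w \<le> x \<Longrightarrow> w + x = x"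
  subgoal using assms add_mono[of w w x w] by (simp add: Idem_iff_add antisym)
  subgoal using assms by (metis Idem_iff_add add.assoc le_iff_add)
  done

lemma Idem_scaleR_le_iff:
  fixes w :: "'a::extended_choquet_cone"
  assumes "w \<in> Idem" "0 < t"
  shows "t *\<^sub>R x \<le> w \<longleftrightarrow> x \<le> w"
proof
  assume "t *\<^sub>R x \<le> w"
  then have "(1 / t) *\<^sub>R (t *\<^sub>R x) \<le> (1 / t) *\<^sub>R w" using assms by (intro scaleR_mono) auto
  then show "x \<le> w" using assms by (simp add: scaleR_inverse_cancel Idem_scaleR)
next
  assume "x \<le> w"
  then show "t *\<^sub>R x \<le> w" using assms scaleR_mono Idem_scaleR by metis
qed

lemma Idem_add_le:
  fixes w :: "'a::extended_choquet_cone"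
  shows "w \<in> Idem \<Longrightarrow> x \<le> w \<Longrightarrow> y \<le> w \<Longrightarrow> x + y \<le> w"
  using add_mono[of x w y w] by (simp add: Idem_iff_add)

lemma Idem_add:
  fixes w :: "'a::extended_choquet_cone"
  shows "w \<in> Idem \<Longrightarrow> v \<in> Idem \<Longrightarrow> w + v \<in> Idem"
  unfolding Idem_iff_add by (metis add.assoc add.commute)

lemma Idem_inf:
  fixes w :: "'a::extended_choquet_cone"
  assumes "w \<in> Idem" "v \<in> Idem"
  shows "inf w v \<in> Idem"
  unfolding Idem_iff_add
proof (rule antisym)
  show "inf w v + inf w v \<le> inf w v"
    using assms by (meson Idem_add_le inf.cobounded1 inf.cobounded2 le_inf_iff)
qed simp

lemma Idem_zero: "(0 :: 'a::extended_choquet_cone) \<in> Idem"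
  by (simp add: Idem_iff_add)

text \<open>A form of Riesz decomposition that does not rely on cancellation: addition is
  distributed over the meet twice, once for each summand.\<close>

lemma le_add_inf:
  fixes x :: "'a::extended_choquet_cone"
  assumes "x \<le> v + v'"
  shows "x \<le> inf x v + inf x v'"
proof -
  have "x \<le> inf x v + v'"
    using assms add_inf_distrib[of v' x v] by (simp add: add.commute)
  then show ?thesis
    using add_inf_distrib[of "inf x v" x v'] by simp
qed

text \<open>An idempotent is determined by the generators below it.\<close>

lemma finite_Idem:
  assumes "finitely_generated TYPE('a::extended_choquet_cone)"
  shows "finite (Idem :: 'a set)"
proof -
  obtain Z :: "'a set" where Z: "finite Z"
    "\<And>x. \<exists>(n::nat) (\<alpha>::nat \<Rightarrow> real) z.
           (\<forall>i\<in>{1..n}. 0 < \<alpha> i \<and> z i \<in> Z) \<and> x = (\<Sum>i=1..n. \<alpha> i *\<^sub>R z i)"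
    using assms unfolding finitely_generated_def by blast
  have le: "w \<le> v" if w: "w \<in> Idem" and v: "v \<in> Idem" and eq: "{z\<in>Z. z \<le> w} = {z\<in>Z. z \<le> v}" for w v :: 'a
  proof -
    obtain n \<alpha> z where z: "\<forall>i\<in>{1..n::nat}. 0 < \<alpha> i \<and> z i \<in> Z" "w = (\<Sum>i=1..n. \<alpha> i *\<^sub>R z i)"
      using Z(2) by blast
    have le: "\<alpha> i *\<^sub>R z i \<le> v" if "i \<in> {1..n}" for i
    proof -
      have "\<alpha> i *\<^sub>R z i \<le> w" using that by (simp add: z(2) sum.remove[of _ i])
      then have "z i \<le> w" using z(1) that w by (simp add: Idem_scaleR_le_iff)
      then have "z i \<le> v" using eq z(1) that by auto
      then show ?thesis using z(1) that v by (simp add: Idem_scaleR_le_iff)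
    qed
    have "(\<Sum>i\<in>I. \<alpha> i *\<^sub>R z i) \<le> v" if "finite I" "I \<subseteq> {1..n}" for I
      using that by (induction I rule: finite_induct) (use Idem_add_le[OF v] le in simp_all)
    then show ?thesis using z(2) by simp
  qed
  have "inj_on (\<lambda>w. {z\<in>Z. z \<le> w}) Idem"
    by (intro inj_onI antisym le) auto
  moreover have "(\<lambda>w. {z\<in>Z. z \<le> w}) ` Idem \<subseteq> Pow Z" by auto
  ultimately show ?thesis
    using Z(1) by (meson finite_Pow_iff inj_on_finite)
qed

section \<open>Support idempotents and cancellation\<close>

lemma closed_translation_eq: "closed {z :: 'a::extended_choquet_cone. z + a = z + b}"
  and closed_translation_eq_const: "closed {z :: 'a::extended_choquet_cone. z + a = b}"
  by (intro closed_Collect_eq continuous_on_add continuous_on_id continuous_on_const)+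

text \<open>The elements absorbed by \<open>x\<close> form a closed set that is stable under
  addition, hence directed upwards. Compactness then provides a maximum, so the
  \<open>GREATEST\<close> in \<open>support_idem\<close> is attained.\<close>

lemma support_idem_greatest:
  fixes x :: "'a::extended_choquet_cone"
  shows "x + support_idem x = x" and "x + z = x \<Longrightarrow> z \<le> support_idem x"
proof -
  let ?A = "{z. z + x = x}"
  have "(\<Inter>z\<in>?A. ?A \<inter> {y. z \<le> y}) \<noteq> {}"
  proof (rule compact_directed_Inter[OF compact_cone])
    fix i j assume "i \<in> ?A" "j \<in> ?A"
    moreover from this have "i + j \<in> ?A" by (simp add: add.assoc)
    moreover have "i \<le> y" "j \<le> y" if "i + j \<le> y" for y
      using order_trans[OF le_add_left that] order_trans[OF le_add_right that] by auto
    ultimately show "\<exists>k\<in>?A. ?A \<inter> {y. k \<le> y} \<subseteq> (?A \<inter> {y. i \<le> y}) \<inter> (?A \<inter> {y. j \<le> y})"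
      by (intro bexI[of _ "i + j"]) auto
  next
    have "0 \<in> ?A" by simp
    then show "?A \<noteq> {}" by blast
  qed (auto intro: closed_Int closed_atLeast_cone closed_translation_eq_const)
  then obtain m where Inter: "m \<in> (\<Inter>z\<in>?A. ?A \<inter> {y. z \<le> y})" by blast
  have mem: "m \<in> ?A \<inter> {y. z \<le> y}" if "z \<in> ?A" for z using Inter that by (rule INT_D)
  have m: "z \<le> m" if "x + z = x" for z using mem[of z] that by (simp add: add.commute)
  have xm: "x + m = x" using mem[of 0] by (simp add: add.commute)
  with m have "support_idem x = m"
    unfolding support_idem_def by (intro Greatest_equality)
  with xm m show "x + support_idem x = x" "x + z = x \<Longrightarrow> z \<le> support_idem x"
    by auto
qed

lemma support_idem_Idem: "support_idem (x::'a::extended_choquet_cone) \<in> Idem"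
proof -
  have "x + (support_idem x + support_idem x) = x"
    by (metis add.assoc support_idem_greatest(1))
  then have "support_idem x + support_idem x \<le> support_idem x"
    by (rule support_idem_greatest(2))
  then show ?thesis by (simp add: Idem_iff_add antisym)
qed

lemma support_idem_le: "support_idem (x::'a::extended_choquet_cone) \<le> x"
  by (metis le_add_right support_idem_greatest(1))

lemma support_idem_mono:
  fixes x y :: "'a::extended_choquet_cone"
  assumes "x \<le> y"
  shows "support_idem x \<le> support_idem y"
proof -
  obtain r where "y = x + r" using assms by (auto simp: le_iff_add)
  then have "y + support_idem x = y"
    by (metis add.assoc add.commute support_idem_greatest(1))
  then show ?thesis by (rule support_idem_greatest(2))
qed

lemma support_idem_scaleR:
  fixes x :: "'a::extended_choquet_cone"
  assumes "0 < t"
  shows "support_idem (t *\<^sub>R x) = support_idem x"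
proof -
  have le: "support_idem (s *\<^sub>R y) \<le> support_idem y" if "0 < s" for s and y :: 'a
  proof -
    let ?e = "support_idem (s *\<^sub>R y)"
    have "(1 / s) *\<^sub>R (s *\<^sub>R y + ?e) = (1 / s) *\<^sub>R (s *\<^sub>R y)"
      by (simp add: support_idem_greatest(1))
    then have "y + ?e = y"
      using that by (simp add: cone_scaleR_add_right scaleR_inverse_cancel Idem_scaleR support_idem_Idem)
    then show ?thesis by (rule support_idem_greatest(2))
  qed
  show ?thesis
    using le[OF assms, of x] le[of "1 / t" "t *\<^sub>R x"] assms
    by (simp add: scaleR_inverse_cancel)
qed

text \<open>The multiples of \<open>x\<close> by \<open>1 + 1 / real (Suc n)\<close> lie above
  \<open>x + p\<close> and converge to \<open>x\<close>. Up-sets are closed, so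
  \<open>x + p \<le> x\<close>, that is, \<open>x\<close> absorbs \<open>p\<close>.\<close>

lemma archimedean_le_support_idem:
  fixes x :: "'a::extended_choquet_cone"
  assumes "\<And>n. p \<le> (1 / real (Suc n)) *\<^sub>R x"
  shows "p \<le> support_idem x"
proof -
  let ?t = "\<lambda>n. 1 + 1 / real (Suc n)"
  have "?t \<longlonglongrightarrow> 1"
    using tendsto_add[OF tendsto_const[of "1::real"] LIMSEQ_inverse_real_of_nat]
    by (simp add: inverse_eq_divide)
  then have "filterlim (\<lambda>n. (?t n, x)) (nhds 1 \<times>\<^sub>F nhds x) sequentially"
    by (intro filterlim_Pair tendsto_const)
  from filterlim_compose[OF tendsto_scaleR_Pair this]
  have lim: "(\<lambda>n. ?t n *\<^sub>R x) \<longlonglongrightarrow> x" by simp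
  have le: "x + p \<le> ?t n *\<^sub>R x" for n
  proof -
    have "?t n *\<^sub>R x = x + (1 / real (Suc n)) *\<^sub>R x"
      using cone_scaleR_add_left[of 1 "1 / real (Suc n)" x] by simp
    then show ?thesis using add_mono[OF order_refl assms] by metis
  qed
  have "x \<in> {y. x + p \<le> y}"
    using le by (intro Lim_in_closed_set[OF closed_atLeast_cone _ sequentially_bot lim]) auto
  then have "x + p = x" by (simp add: antisym)
  then show ?thesis by (rule support_idem_greatest(2))
qed

text \<open>
  Iterating the equation \<open>n\<close> times and dividing by \<open>n\<close> replaces \<open>x\<close> by \<open>(1/n) x\<close>.
  By compactness some \<open>p\<close> below all the \<open>(1/n) x\<close> satisfies the same equation.
\<close>

lemma add_left_cancel_support_idem:
  fixes x y z :: "'a::extended_choquet_cone"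
  assumes eq: "x + y = x + z"
  shows "support_idem x + y = support_idem x + z"
proof -
  let ?r = "\<lambda>n. 1 / real (Suc n)"
  have iter: "x + real (Suc n) *\<^sub>R y = x + real (Suc n) *\<^sub>R z" for n
  proof (induction n)
    case (Suc n)
    have S: "real (Suc (Suc n)) *\<^sub>R u = real (Suc n) *\<^sub>R u + u" for u :: 'a
      using cone_scaleR_add_left[of "real (Suc n)" 1 u] by (simp add: add.commute)
    have "x + real (Suc (Suc n)) *\<^sub>R y = (x + real (Suc n) *\<^sub>R y) + y"
      by (simp only: S add.assoc)
    also have "\<dots> = (x + y) + real (Suc n) *\<^sub>R z"
      unfolding Suc by (simp only: ac_simps)
    also have "\<dots> = x + real (Suc (Suc n)) *\<^sub>R z"
      unfolding eq S by (simp only: ac_simps)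
    finally show ?case .
  qed (simp add: eq)
  have div: "?r n *\<^sub>R x + y = ?r n *\<^sub>R x + z" for n
  proof -
    have pos: "0 < real (Suc n)" by simp
    have "?r n *\<^sub>R x + u = ?r n *\<^sub>R (x + real (Suc n) *\<^sub>R u)" for u :: 'a
      using cone_scaleR_add_right[of "?r n" x] scaleR_inverse_cancel(1)[OF pos, of u] pos by simp
    then show ?thesis by (simp only: iter)
  qed
  have "(\<Inter>n. {p. p + y = p + z} \<inter> {p. p \<le> ?r n *\<^sub>R x}) \<noteq> {}"
  proof (rule compact_directed_Inter[OF compact_cone])
    fix i j :: nat
    have "?r (max i j) *\<^sub>R x \<le> ?r k *\<^sub>R x" if "k \<le> max i j" for k
      using that by (intro scaleR_le_scaleR) (auto simp: field_simps)
    then show "\<exists>k\<in>UNIV. {p. p + y = p + z} \<inter> {p. p \<le> ?r k *\<^sub>R x}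
        \<subseteq> ({p. p + y = p + z} \<inter> {p. p \<le> ?r i *\<^sub>R x}) \<inter> ({p. p + y = p + z} \<inter> {p. p \<le> ?r j *\<^sub>R x})"
      by (intro bexI[of _ "max i j"]) (auto intro: order_trans)
  next
    fix n
    have "?r n *\<^sub>R x \<in> {p. p + y = p + z} \<inter> {p. p \<le> ?r n *\<^sub>R x}" using div by simp
    then show "{p. p + y = p + z} \<inter> {p. p \<le> ?r n *\<^sub>R x} \<noteq> {}" by blast
  qed (auto intro: closed_Int closed_translation_eq closed_atMost_cone)
  then obtain p where p: "p + y = p + z" "\<And>n. p \<le> ?r n *\<^sub>R x" by auto
  \<comment> \<open>The support idempotent absorbs \<open>p\<close>, so adding it to both sides of
    \<open>p + y = p + z\<close> makes \<open>p\<close> disappear.\<close>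
  then have "support_idem x + p = support_idem x"
    by (intro Idem_add_absorb(1) support_idem_Idem archimedean_le_support_idem)
  then show ?thesis using p(1) by (metis add.assoc)
qed

section \<open>The cones \<open>cone_at w\<close> and minimum extensions\<close>

lemma cone_at_ge:
  fixes x :: "'a::extended_choquet_cone"
  assumes "x \<in> cone_at w"
  shows "w \<le> x" "w + x = x" "w \<in> Idem"
  using assms support_idem_le support_idem_greatest(1)[of x] support_idem_Idem
  by (auto simp: cone_at_def add.commute)

text \<open>Adding \<open>w\<close> moves everything below \<open>x\<close> into the cone:
  \<open>y + w\<close> absorbs \<open>w\<close>, and it stays below \<open>x\<close>, which bounds
  its support idempotent by \<open>w\<close>.\<close>

lemma cone_at_lower:
  fixes x :: "'a::extended_choquet_cone"
  assumes "x \<in> cone_at w" "y \<le> x"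
  shows "y + w \<in> cone_at w"
proof -
  have "y + w \<le> x"
    using cone_at_ge[OF assms(1)] add_mono[OF assms(2) order_refl[of w]]
    by (simp add: add.commute)
  then have "support_idem (y + w) \<le> w"
    using support_idem_mono assms(1) by (fastforce simp: cone_at_def)
  moreover have "(y + w) + w = y + w"
    using cone_at_ge(3)[OF assms(1)] by (simp add: Idem_iff_add add.assoc)
  then have "w \<le> support_idem (y + w)" by (rule support_idem_greatest(2))
  ultimately show ?thesis by (simp add: cone_at_def antisym)
qed

text \<open>Extremality only speaks of summands inside \<open>cone_at w\<close>. Adding
  \<open>w\<close> to both parts of \<open>x = y + r\<close> yields such summands from an arbitrary
  \<open>y\<close> below \<open>x\<close>.\<close>

lemma extreme_ray_below:
  fixes x :: "'a::extended_choquet_cone"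
  assumes "generates_extreme_ray w x" "y \<le> x"
  shows "y + w = w \<or> (\<exists>t>0. y + w = t *\<^sub>R x)"
proof -
  have x: "x \<in> cone_at w" using assms by (simp add: generates_extreme_ray_def)
  obtain r where r: "x = y + r" using assms(2) by (auto simp: le_iff_add)
  have "r \<le> x" using r by simp
  moreover have "x = (y + w) + (r + w)"
    using r cone_at_ge(2,3)[OF x] unfolding Idem_iff_add by (metis add.assoc add.commute)
  ultimately show ?thesis
    using assms cone_at_lower[OF x] unfolding generates_extreme_ray_def by blast
qed

text \<open>Distributivity over the meet makes the set of extensions directed downwards. It is
  closed, and \<open>w \<le> x\<close> makes it nonempty, so compactness provides a minimum.\<close>

lemma min_extension_least:
  fixes x :: "'a::extended_choquet_cone"
  assumes "w \<le> x"
  shows "min_extension w x + w = x" and "z + w = x \<Longrightarrow> min_extension w x \<le> z"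
proof -
  let ?E = "{z. z + w = x}"
  have "(\<Inter>z\<in>?E. ?E \<inter> {y. y \<le> z}) \<noteq> {}"
  proof (rule compact_directed_Inter[OF compact_cone])
    fix i j assume "i \<in> ?E" "j \<in> ?E"
    moreover from this have "inf i j \<in> ?E"
      using add_inf_distrib[of w i j] by (simp add: add.commute)
    ultimately show "\<exists>k\<in>?E. ?E \<inter> {y. y \<le> k} \<subseteq> (?E \<inter> {y. y \<le> i}) \<inter> (?E \<inter> {y. y \<le> j})"
      by (intro bexI[of _ "inf i j"]) auto
  next
    show "?E \<noteq> {}" using assms by (auto simp: le_iff_add add.commute)
  qed (auto intro: closed_Int closed_atMost_cone closed_translation_eq_const)
  then obtain m where Inter: "m \<in> (\<Inter>z\<in>?E. ?E \<inter> {y. y \<le> z})" by blast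
  have mem: "m \<in> ?E \<inter> {y. y \<le> z}" if "z \<in> ?E" for z using Inter that by (rule INT_D)
  then have m: "m \<le> z" if "z + w = x" for z using that by auto
  obtain z where "z + w = x" using assms by (auto simp: le_iff_add add.commute)
  then have mx: "m + w = x" using mem[of z] by simp
  with m have "min_extension w x = m"
    unfolding min_extension_def by (intro Greatest_equality) auto
  with m mx show "min_extension w x + w = x" "z + w = x \<Longrightarrow> min_extension w x \<le> z" for z
    by auto
qed

section \<open>Extreme extensions\<close>

lemma extreme_extensionsE:
  fixes x :: "'a::extended_choquet_cone"
  assumes "x \<in> extreme_extensions"
  obtains w where "generates_extreme_ray w (x + w)" "w \<in> Idem" "\<And>z. z + w = x + w \<Longrightarrow> x \<le> z"
    "x + w \<noteq> w"
proof -
  obtain w y where y: "w \<in> Idem" "generates_extreme_ray w y" "x = min_extension w y"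
    using assms by (auto simp: extreme_extensions_def extreme_extensions_at_def)
  then have "w \<le> y" "y \<noteq> w" by (auto simp: generates_extreme_ray_def cone_at_ge)
  with y min_extension_least[of w y] show ?thesis
    by (intro that[of w]) auto
qed

text \<open>For an idempotent \<open>u\<close>, extremality makes \<open>inf x u + w\<close> either
  \<open>w\<close> or a multiple of \<open>x + w\<close>. In the second case a rescaled
  \<open>inf x u\<close> is an extension of \<open>x + w\<close>, so leastness of \<open>x\<close>
  gives \<open>x \<le> u\<close>. If the first case held for both \<open>v\<close> and
  \<open>v'\<close>, then \<open>le_add_inf\<close> would give \<open>x \<le> w\<close>, against
  \<open>x + w \<noteq> w\<close>.\<close>

lemma extreme_extension_prime:
  fixes x :: "'a::extended_choquet_cone"
  assumes x: "x \<in> extreme_extensions" and idem: "v \<in> Idem" "v' \<in> Idem" and le: "x \<le> v + v'"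
  shows "x \<le> v \<or> x \<le> v'"
proof -
  obtain w where w: "generates_extreme_ray w (x + w)" "w \<in> Idem" "x + w \<noteq> w"
    and least: "\<And>z. z + w = x + w \<Longrightarrow> x \<le> z"
    using extreme_extensionsE[OF x] by metis
  have dich: "inf x u + w = w \<or> x \<le> u" if "u \<in> Idem" for u
  proof -
    have "inf x u \<le> x + w" by (simp add: le_infI1)
    from extreme_ray_below[OF w(1) this] consider "inf x u + w = w"
      | t where "0 < t" "inf x u + w = t *\<^sub>R (x + w)" by blast
    then show ?thesis
    proof cases
      case (2 t)
      then have "(1 / t) *\<^sub>R (inf x u + w) = x + w" by (simp add: scaleR_inverse_cancel)
      then have "(1 / t) *\<^sub>R inf x u + w = x + w"
        using \<open>0 < t\<close> w(2) by (simp add: cone_scaleR_add_right Idem_scaleR)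
      then have "x \<le> (1 / t) *\<^sub>R inf x u" by (rule least)
      also have "\<dots> \<le> u" using \<open>0 < t\<close> that by (simp add: Idem_scaleR_le_iff)
      finally show ?thesis ..
    qed simp
  qed
  show ?thesis
  proof (rule ccontr)
    assume "\<not> ?thesis"
    then have "inf x v + w = w" "inf x v' + w = w" using dich idem by auto
    then have "(inf x v + inf x v') + w = w" by (simp add: add.assoc)
    then have "x \<le> w" using le_add_inf[OF le] by (metis le_add_left order_trans)
    then show False using w Idem_add_absorb(1)[of w x] by (simp add: add.commute)
  qed
qed

text \<open>Positive combinations of \<open>S\<close> in a cone with zero element \<open>w\<close>.
  Scalars are strictly positive, so the empty combination \<open>w\<close> is a separate base
  case.\<close>

inductive_set cone_span :: "'a::extended_choquet_cone \<Rightarrow> 'a set \<Rightarrow> 'a set" for w S where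
  base: "w \<in> cone_span w S"
| step: "s \<in> S \<Longrightarrow> 0 < t \<Longrightarrow> h \<in> cone_span w S \<Longrightarrow> t *\<^sub>R s + h \<in> cone_span w S"

lemma cone_span_ge: "h \<in> cone_span w S \<Longrightarrow> w \<le> h"
  by (induction rule: cone_span.induct) (auto intro: order_trans)

lemma cone_span_add:
  assumes "w \<in> Idem" "h \<in> cone_span w S" "k \<in> cone_span w S"
  shows "h + k \<in> cone_span w S"
proof -
  have "w + k = k" using assms cone_span_ge Idem_add_absorb(2) by blast
  from assms(2) show ?thesis
    by (induction rule: cone_span.induct)
       (use \<open>w + k = k\<close> assms(3) in \<open>auto simp: add.assoc intro: cone_span.intros\<close>)
qed

lemma cone_span_scaleR:
  assumes "w \<in> Idem" "h \<in> cone_span w S" "0 < t"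
  shows "t *\<^sub>R h \<in> cone_span w S"
  using assms(2)
  by (induction rule: cone_span.induct)
     (use assms in \<open>auto simp: Idem_scaleR cone_scaleR_add_right cone_scaleR_scaleR intro: cone_span.intros\<close>)

text \<open>Collects all occurrences of \<open>s\<close> into one coefficient. As there is no scalar
  zero, absence of \<open>s\<close> is a case of its own.\<close>

lemma cone_span_insert:
  assumes "h \<in> cone_span w (insert s S)"
  obtains "h \<in> cone_span w S" | t k where "0 < t" "k \<in> cone_span w S" "h = t *\<^sub>R s + k"
proof -
  have "h \<in> cone_span w S \<or> (\<exists>t>0. \<exists>k\<in>cone_span w S. h = t *\<^sub>R s + k)"
    using assms
  proof (induction rule: cone_span.induct)
    case base
    then show ?case by (simp add: cone_span.base)
  next
    case (step r a h)
    show ?case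
    proof (cases "r = s")
      case True
      from step.IH show ?thesis
      proof (elim disjE exE bexE conjE)
        assume "h \<in> cone_span w S"
        then show ?thesis using step True by blast
      next
        fix t k assume tk: "0 < t" "k \<in> cone_span w S" "h = t *\<^sub>R s + k"
        then have "a *\<^sub>R r + h = (a + t) *\<^sub>R s + k"
          using step.hyps True by (simp add: cone_scaleR_add_left add.assoc)
        moreover have "0 < a + t" using step.hyps tk by simp
        ultimately show ?thesis using tk by blast
      qed
    next
      case False
      then have "r \<in> S" using step.hyps by simp
      from step.IH show ?thesis
      proof (elim disjE exE bexE conjE)
        assume "h \<in> cone_span w S"
        then show ?thesis using step \<open>r \<in> S\<close> by (simp add: cone_span.step)
      next
        fix t k assume tk: "0 < t" "k \<in> cone_span w S" "h = t *\<^sub>R s + k"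
        then have "a *\<^sub>R r + h = t *\<^sub>R s + (a *\<^sub>R r + k)" by (simp add: ac_simps)
        moreover have "a *\<^sub>R r + k \<in> cone_span w S"
          using step tk \<open>r \<in> S\<close> by (simp add: cone_span.step)
        ultimately show ?thesis using tk by blast
      qed
    qed
  qed
  then show ?thesis using that by blast
qed

lemma cone_span_insert_redundant:
  assumes "w \<in> Idem" "s \<in> cone_span w S"
  shows "cone_span w (insert s S) \<subseteq> cone_span w S"
  using assms by (auto elim!: cone_span_insert intro!: cone_span_add cone_span_scaleR)

text \<open>
  Members of a minimal generating set of the hereditary subcone \<open>{x \<in> cone_at w. x \<le> v}\<close>
  generate extreme rays: by cancellation, a decomposition of such a member involving
  other generators would make it redundant.
\<close>

lemma extreme_ray_exists:
  fixes z :: "'a::extended_choquet_cone"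
  assumes fg: "finitely_generated TYPE('a)" and v: "v \<in> Idem"
    and z: "z \<in> cone_at w" "z \<noteq> w" "z \<le> v"
  shows "\<exists>x\<le>v. generates_extreme_ray w x"
proof -
  define D where "D = {x \<in> cone_at w. x \<le> v}"
  have w: "w \<in> Idem" "w \<le> v" using cone_at_ge[OF z(1)] z(3) by auto
  have D_lower: "y + w \<in> D" if "x \<in> D" "y \<le> x" for x y
    using that cone_at_lower[of x w y] Idem_add_le[OF v _ w(2)] by (auto simp: D_def intro: order_trans)
  obtain Z :: "'a set" where Z: "finite Z"
    "\<And>x. \<exists>(n::nat) (\<alpha>::nat \<Rightarrow> real) z.
           (\<forall>i\<in>{1..n}. 0 < \<alpha> i \<and> z i \<in> Z) \<and> x = (\<Sum>i=1..n. \<alpha> i *\<^sub>R z i)"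
    using fg unfolding finitely_generated_def by blast
  define Q where "Q = (\<lambda>T. finite T \<and> T \<subseteq> D - {w} \<and> D \<subseteq> cone_span w T)"
  \<comment> \<open>The given generators, pushed above \<open>w\<close>; those that collapse to
    \<open>w\<close> or leave \<open>D\<close> are dropped.\<close>
  define T0 where "T0 = (\<lambda>z. z + w) ` Z \<inter> (D - {w})"
  have "D \<subseteq> cone_span w T0"
  proof
    fix x assume x: "x \<in> D"
    obtain n \<alpha> y where y: "\<forall>i\<in>{1..n::nat}. 0 < \<alpha> i \<and> y i \<in> Z" "x = (\<Sum>i=1..n. \<alpha> i *\<^sub>R y i)"
      using Z(2) by blast
    have *: "(\<Sum>i\<in>I. \<alpha> i *\<^sub>R y i) + w \<in> cone_span w T0" if "finite I" "I \<subseteq> {1..n}" for I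
      using that
    proof (induction I rule: finite_induct)
      case empty
      then show ?case by (simp add: cone_span.base)
    next
      case (insert i I)
      then have i: "0 < \<alpha> i" "y i \<in> Z" using y(1) by auto
      let ?h = "(\<Sum>i\<in>I. \<alpha> i *\<^sub>R y i) + w"
      have h: "?h \<in> cone_span w T0" using insert by auto
      have "\<alpha> i *\<^sub>R y i \<le> x" using insert.prems by (simp add: y(2) sum.remove[of _ i])
      then have yD: "\<alpha> i *\<^sub>R y i + w \<in> D" using D_lower x by blast
      have sc: "\<alpha> i *\<^sub>R (y i + w) = \<alpha> i *\<^sub>R y i + w"
        using i w by (simp add: cone_scaleR_add_right Idem_scaleR)
      have eq: "(\<Sum>i\<in>insert i I. \<alpha> i *\<^sub>R y i) + w = \<alpha> i *\<^sub>R (y i + w) + ?h"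
      proof -
        have "\<alpha> i *\<^sub>R (y i + w) + ?h = \<alpha> i *\<^sub>R y i + (\<Sum>i\<in>I. \<alpha> i *\<^sub>R y i) + (w + w)"
          unfolding sc by (simp only: ac_simps)
        then show ?thesis using insert.hyps w(1) by (simp add: Idem_iff_add)
      qed
      show ?case
      proof (cases "y i + w = w")
        case True
        then have "\<alpha> i *\<^sub>R (y i + w) + ?h = ?h"
          using i w by (simp add: Idem_scaleR Idem_add_absorb(2))
        then show ?thesis using eq h by simp
      next
        case False
        \<comment> \<open>Undoing the scaling by \<open>\<alpha> i\<close> stays in
          \<open>D\<close>: support idempotents ignore positive scalars, and so does lying below the
          idempotent \<open>v\<close>.\<close>
        have "y i + w \<in> D"
          using yD i v w support_idem_scaleR[of "\<alpha> i" "y i + w"] Idem_scaleR_le_iff[of v "\<alpha> i" "y i + w"]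
          by (simp add: D_def cone_at_def sc)
        then have "y i + w \<in> T0" using False i by (simp add: T0_def)
        then show ?thesis using eq h i by (simp add: cone_span.step)
      qed
    qed
    have "x + w = x" using x cone_at_ge(2)[of x w] by (simp add: D_def add.commute)
    then show "x \<in> cone_span w T0" using *[of "{1..n}"] y(2) by simp
  qed
  then have "Q T0" using Z(1) by (auto simp: Q_def T0_def)
  then obtain T where T: "Q T" and min: "\<And>T'. Q T' \<Longrightarrow> card T \<le> card T'"
    using ex_has_least_nat[of Q T0 card] by blast
  have "T \<noteq> {}"
  proof
    assume "T = {}"
    then have "z \<in> cone_span w {}" using T z by (auto simp: Q_def D_def)
    then show False using z(2) by cases auto
  qed
  then obtain s where s: "s \<in> T" by blast
  then have sD: "s \<in> D" "s \<in> cone_at w" "s \<noteq> w" "s \<le> v" using T by (auto simp: Q_def D_def)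
  let ?T = "T - {s}"
  have span: "y \<in> cone_span w (insert s ?T)" if "y \<in> D" for y
    using that T s by (auto simp: Q_def insert_absorb)
  have irred: "s \<notin> cone_span w ?T"
  proof
    assume "s \<in> cone_span w ?T"
    then have "D \<subseteq> cone_span w ?T"
      using cone_span_insert_redundant[OF w(1)] span by blast
    then have "Q ?T" using T by (auto simp: Q_def)
    then have "card T \<le> card ?T" by (rule min)
    then show False using T s by (metis Q_def card_Diff1_less not_le)
  qed
  \<comment> \<open>For \<open>\<gamma> < 1\<close>, cancelling \<open>\<gamma> *\<^sub>R s\<close>
    expresses \<open>s\<close> through the other generators, against \<open>irred\<close>. For
    \<open>\<gamma> \<ge> 1\<close>, \<open>s\<close> absorbs \<open>r\<close>, so \<open>r\<close>
    lies below its support idempotent \<open>w\<close>.\<close>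
  have key: "r \<le> w" if "s = \<gamma> *\<^sub>R s + r" "0 < \<gamma>" "r \<in> cone_span w ?T" for \<gamma> r
  proof (cases "\<gamma> < 1")
    case True
    then have "\<gamma> *\<^sub>R s + (1 - \<gamma>) *\<^sub>R s = \<gamma> *\<^sub>R s + r"
      using that cone_scaleR_add_left[of \<gamma> "1 - \<gamma>" s] by simp
    from add_left_cancel_support_idem[OF this]
    have "w + (1 - \<gamma>) *\<^sub>R s = w + r"
      using that sD by (simp add: support_idem_scaleR cone_at_def)
    moreover have "w + r = r" using that w by (simp add: Idem_add_absorb(2) cone_span_ge)
    moreover have "w + (1 - \<gamma>) *\<^sub>R s = (1 - \<gamma>) *\<^sub>R s"
      using True sD w cone_at_ge(2)[of s w] cone_scaleR_add_right[of "1 - \<gamma>" w s] Idem_scaleR[of w "1 - \<gamma>"]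
      by simp
    ultimately have "s = (1 / (1 - \<gamma>)) *\<^sub>R r"
      using True scaleR_inverse_cancel(1)[of "1 - \<gamma>" s] by simp
    then have False using irred True that cone_span_scaleR[OF w(1), of r ?T "1 / (1 - \<gamma>)"] by simp
    then show ?thesis ..
  next
    case False
    have "s + r \<le> \<gamma> *\<^sub>R s + r"
      using False scaleR_le_scaleR[of 1 \<gamma> s] by (intro add_mono) auto
    then have "s + r = s" using that by (simp add: antisym)
    then show ?thesis using support_idem_greatest(2) sD by (metis (mono_tags) cone_at_def mem_Collect_eq)
  qed
  \<comment> \<open>Expand \<open>y\<close> and \<open>z\<close> in the generators. By
    \<open>irred\<close> at least one expansion contains \<open>s\<close>, and then
    \<open>key\<close> forces all remaining terms down to \<open>w\<close>.\<close>
  have decomp: "y = w \<or> (\<exists>t>0. y = t *\<^sub>R s)" if yz: "y \<in> cone_at w" "z \<in> cone_at w" "s = y + z" for y z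
  proof -
    have "y + w \<in> D" "z + w \<in> D" using D_lower[OF sD(1)] yz(3) by auto
    then have "y \<in> D" "z \<in> D" using yz cone_at_ge(2) by (metis add.commute)+
    then have span_y: "y \<in> cone_span w (insert s ?T)" and span_z: "z \<in> cone_span w (insert s ?T)"
      using span by auto
    have kw: "k = w" if "k \<in> cone_span w ?T" "k \<le> w" for k
      using that cone_span_ge antisym by blast
    have sw: "t *\<^sub>R s + w = t *\<^sub>R s" if "0 < t" for t
      using that sD w cone_at_ge(2)[of s w] cone_scaleR_add_right[of t s w] Idem_scaleR[of w t]
      by (simp add: add.commute)
    from span_y show ?thesis
    proof (cases rule: cone_span_insert)
      case y: 1
      from span_z show ?thesis
      proof (cases rule: cone_span_insert)
        case 1
        then show ?thesis using irred y yz(3) cone_span_add w(1) by metis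
      next
        case (2 t k)
        have "s = t *\<^sub>R s + (y + k)" using yz(3) 2(3) by (metis add.left_commute)
        then have "y + k \<le> w" using 2(1) cone_span_add[OF w(1) y 2(2)] by (rule key)
        from order_trans[OF le_add_left this] have "y \<le> w" .
        then show ?thesis using kw y by blast
      qed
    next
      case y: (2 t k)
      have "k \<le> w"
      proof (use span_z in \<open>cases rule: cone_span_insert\<close>)
        case 1
        have "s = t *\<^sub>R s + (k + z)" using yz(3) y(3) by (metis add.assoc)
        then have "k + z \<le> w" using y(1) cone_span_add[OF w(1) y(2) 1] by (rule key)
        from order_trans[OF le_add_left this] show ?thesis .
      next
        case (2 t' k')
        have "s = (t *\<^sub>R s + k) + (t' *\<^sub>R s + k')" using yz(3) y(3) 2(3) by metis
        also have "\<dots> = (t + t') *\<^sub>R s + (k + k')"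
          unfolding cone_scaleR_add_left[OF y(1) 2(1)] by (simp only: ac_simps)
        finally have "k + k' \<le> w"
          using add_pos_pos[OF y(1) 2(1)] cone_span_add[OF w(1) y(2) 2(2)] by (rule key)
        from order_trans[OF le_add_left this] show ?thesis .
      qed
      then show ?thesis using kw[OF y(2)] y(1,3) sw[OF y(1)] by auto
    qed
  qed
  have "generates_extreme_ray w s"
    unfolding generates_extreme_ray_def
    using sD decomp by (metis Diff_iff add.commute singletonD)
  then show ?thesis using sD by blast
qed

text \<open>Translation by \<open>w\<close> maps the connected set below \<open>v\<close> onto a
  connected set containing \<open>w\<close> and \<open>v\<close>. In a Hausdorff space a connected
  set cannot consist of just these two points, and any third one serves as \<open>z\<close>.\<close>

lemma strongly_connected_between:
  fixes w v :: "'a::extended_choquet_cone"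
  assumes sc: "strongly_connected TYPE('a)" and "w \<in> Idem" "v \<in> Idem" "w < v"
  obtains z where "w < z" "z < v" "w + z = z"
proof -
  define K where "K = (\<lambda>x. x + w) ` {x. x \<le> v}"
  have "connected K"
    using sc \<open>v \<in> Idem\<close> unfolding K_def strongly_connected_def
    by (intro connected_continuous_image continuous_on_add continuous_on_id continuous_on_const) auto
  have "w \<in> K" unfolding K_def by (rule image_eqI[of _ _ 0]) auto
  have "v \<in> K"
    unfolding K_def using Idem_add_absorb(1)[OF \<open>v \<in> Idem\<close>, of w] \<open>w < v\<close> by (intro image_eqI[of _ _ v]) auto
  have "\<not> K \<subseteq> {w, v}"
  proof
    assume K: "K \<subseteq> {w, v}"
    have "\<exists>U V. open U \<and> open V \<and> w \<in> U \<and> v \<in> V \<and> U \<inter> V = {}"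
      using \<open>w < v\<close> hausdorff[of w v] by blast
    then obtain U V where "open U" "open V" "w \<in> U" "v \<in> V" "U \<inter> V = {}" by blast
    moreover have "K \<subseteq> U \<union> V" using \<open>w \<in> U\<close> \<open>v \<in> V\<close> K by auto
    ultimately show False
      using connectedD[OF \<open>connected K\<close>, of U V] \<open>w \<in> K\<close> \<open>v \<in> K\<close> by auto
  qed
  then obtain x where x: "x \<le> v" "x + w \<noteq> w" "x + w \<noteq> v" by (auto simp: K_def)
  have "x + w \<le> v" using x \<open>w < v\<close> Idem_add_le[OF \<open>v \<in> Idem\<close>] by simp
  then show thesis
    using x \<open>w \<in> Idem\<close>
    by (intro that[of "x + w"]) (auto simp: less_le Idem_add_absorb(2))
qed

text \<open>
  Connectedness of \<open>{x. x \<le> v'}\<close> for an idempotent \<open>v'\<close> covering \<open>w\<close> makes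
  \<open>cone_at w\<close> nontrivial below \<open>v'\<close>.
\<close>

lemma separating_representative:
  fixes w v :: "'a::extended_choquet_cone"
  assumes fg: "finitely_generated TYPE('a)" and sc: "strongly_connected TYPE('a)"
    and X: "ray_representatives extreme_extensions X"
    and idem: "w \<in> Idem" "v \<in> Idem" and "w < v"
  obtains x where "x \<in> X" "x \<le> v" "\<not> x \<le> w" "support_idem x \<le> w"
proof -
  let ?I = "{u \<in> Idem. w < u \<and> u \<le> v}"
  have "finite ?I" "?I \<noteq> {}" using finite_Idem[OF fg] idem \<open>w < v\<close> by auto
  \<comment> \<open>A minimal element of the finite set \<open>?I\<close>, so that no idempotent
    lies strictly between \<open>w\<close> and \<open>v'\<close>.\<close>
  then obtain v' where v': "v' \<in> Idem" "w < v'" "v' \<le> v"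
    and cover: "\<And>u. u \<in> ?I \<Longrightarrow> u \<le> v' \<Longrightarrow> u = v'"
    using finite_has_minimal[of ?I] by blast
  obtain z where z: "w < z" "z < v'" "w + z = z"
    using strongly_connected_between[OF sc idem(1) v'(1,2)] .
  \<comment> \<open>The support idempotent of \<open>z\<close> lies between \<open>w\<close> and
    \<open>v'\<close> and differs from \<open>v'\<close>, so minimality of \<open>v'\<close> makes
    it \<open>w\<close>.\<close>
  have "w \<le> support_idem z" using z by (intro support_idem_greatest(2)) (simp add: add.commute)
  moreover have "support_idem z < v'" using support_idem_le z(2) by (rule le_less_trans)
  ultimately have "support_idem z = w"
    using cover[of "support_idem z"] support_idem_Idem[of z] v'(3) by fastforce
  then have "z \<in> cone_at w" by (simp add: cone_at_def)
  then obtain y where y: "y \<le> v'" "generates_extreme_ray w y"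
    using extreme_ray_exists[OF fg v'(1)] z by (metis less_imp_le less_irrefl)
  define u where "u = min_extension w y"
  have yw: "y \<in> cone_at w" "y \<noteq> w" using y by (auto simp: generates_extreme_ray_def)
  then have uw: "u + w = y" unfolding u_def by (intro min_extension_least cone_at_ge)
  have u: "u \<in> extreme_extensions"
    using y idem by (auto simp: u_def extreme_extensions_def extreme_extensions_at_def)
  obtain x t where x: "x \<in> X" "0 < t" "x = t *\<^sub>R u"
    using X u unfolding ray_representatives_def by blast
  have "u \<le> y" using uw by auto
  then have "support_idem u \<le> w" "u \<le> v"
    using support_idem_mono[of u y] yw y v' by (auto simp: cone_at_def)
  moreover have "\<not> u \<le> w"
    using uw yw Idem_add_absorb(1)[OF idem(1), of u] by (auto simp: add.commute)
  ultimately show thesis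
    using x idem by (intro that[of x]) (auto simp: support_idem_scaleR Idem_scaleR_le_iff)
qed

section \<open>Positive functions\<close>

text \<open>Names the idempotent that witnesses positivity, so that its uniqueness and its behaviour
  under sums can be stated.\<close>

definition positive_at :: "'a::extended_choquet_cone set \<Rightarrow> 'a \<Rightarrow> ('a \<Rightarrow> real) \<Rightarrow> bool" where
  "positive_at X w f \<longleftrightarrow> w \<in> Idem \<and> f \<in> function_space X \<and> (\<forall>x\<in>X. x \<le> w \<longrightarrow> f x = 0) \<and>
     (\<forall>x\<in>X. \<not> x \<le> w \<longrightarrow> support_idem x \<le> w \<longrightarrow> 0 < f x)"

lemma positive_functions_iff: "f \<in> positive_functions X \<longleftrightarrow> (\<exists>w. positive_at X w f)"
  by (auto simp: positive_functions_def positive_at_def O_set_def P_set_def)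

text \<open>Where the support idempotent is below the meet, each function is positive or vanishes
  because \<open>x\<close> is below its own idempotent. Both vanish only if \<open>x\<close> is
  below the meet.\<close>

lemma positive_at_add:
  assumes "positive_at X w f" "positive_at X v g"
  shows "positive_at X (inf w v) (f + g)"
  unfolding positive_at_def
proof (intro conjI ballI impI)
  fix x assume x: "x \<in> X" "\<not> x \<le> inf w v" "support_idem x \<le> inf w v"
  then have "0 < f x \<or> x \<le> w \<and> f x = 0" "0 < g x \<or> x \<le> v \<and> g x = 0"
    using assms by (auto simp: positive_at_def)
  with x show "0 < (f + g) x" by (auto simp: plus_fun_def)
qed (use assms in \<open>auto simp: positive_at_def function_space_def Idem_inf\<close>)

text \<open>If \<open>w\<close> is not below \<open>v\<close>, separate \<open>inf w v\<close> from
  \<open>w\<close>: the resulting \<open>x\<close> is below \<open>w\<close>, so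
  \<open>f x = 0\<close>, but it is not below \<open>v\<close> while its support idempotent is, so
  \<open>0 < f x\<close>.\<close>

lemma positive_at_unique:
  fixes X :: "'a::extended_choquet_cone set"
  assumes fg: "finitely_generated TYPE('a)" and sc: "strongly_connected TYPE('a)"
    and X: "ray_representatives extreme_extensions X"
    and pos: "positive_at X w f" "positive_at X v f"
  shows "w = v"
proof -
  have le: "w \<le> v" if pos: "positive_at X w f" "positive_at X v f" for w v
  proof (rule ccontr)
    assume "\<not> w \<le> v"
    then have "inf w v < w" by (metis inf.cobounded1 inf.cobounded2 less_le)
    moreover have "w \<in> Idem" "inf w v \<in> Idem" using pos Idem_inf by (auto simp: positive_at_def)
    ultimately obtain x where "x \<in> X" "x \<le> w" "\<not> x \<le> inf w v" "support_idem x \<le> inf w v"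
      using separating_representative[OF fg sc X, of "inf w v" w] by blast
    then show False using pos by (auto simp: positive_at_def)
  qed
  from le[OF pos] le[OF pos(2,1)] show ?thesis by simp
qed

lemma positive_at_zero:
  assumes "\<forall>x. x \<le> T"
  shows "positive_at X T 0"
proof -
  have "T + T \<le> T" using assms by blast
  then have "T \<in> Idem" by (simp add: Idem_iff_add antisym)
  then show ?thesis using assms by (auto simp: positive_at_def function_space_def)
qed

text \<open>Consequently positivity at the idempotent \<open>0\<close> forces no zeros on
  \<open>X\<close>, and every function strictly positive on \<open>X\<close> qualifies.\<close>

lemma representatives_not_le_zero:
  fixes X :: "'a::extended_choquet_cone set"
  assumes "ray_representatives extreme_extensions X" "x \<in> X"
  shows "\<not> x \<le> 0"
proof
  assume "x \<le> 0"
  then have "x = 0" by (simp add: antisym)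
  moreover have "x \<in> extreme_extensions" using assms by (auto simp: ray_representatives_def)
  ultimately show False by (auto elim: extreme_extensionsE)
qed

lemma ordered_vector_space_positive_functions:
  fixes X :: "'a::extended_choquet_cone set"
  assumes fg: "finitely_generated TYPE('a)" and sc: "strongly_connected TYPE('a)"
    and X: "ray_representatives extreme_extensions X"
  shows "ordered_vector_space (function_space X) (positive_functions X)"
  unfolding ordered_vector_space_def
proof (intro conjI ballI allI impI)
  show "subspace (function_space X)"
    by (auto simp: subspace_def function_space_def scaleR_fun_def)
  show "positive_functions X \<subseteq> function_space X"
    by (auto simp: positive_functions_def)
  show "f + g \<in> positive_functions X" if "f \<in> positive_functions X" "g \<in> positive_functions X" for f g
    using that positive_at_add unfolding positive_functions_iff by blast
  show "t *\<^sub>R f \<in> positive_functions X" if "0 < t" "f \<in> positive_functions X" for t f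
    using that by (fastforce simp: positive_functions_iff positive_at_def function_space_def scaleR_fun_def)
  show "function_space X = {f - g |f g. f \<in> positive_functions X \<and> g \<in> positive_functions X}"
  proof (intro set_eqI iffI)
    fix f assume f: "f \<in> function_space X"
    \<comment> \<open>Both \<open>g\<close> and \<open>f + g\<close> are strictly positive
      throughout \<open>X\<close>.\<close>
    define g where "g = (\<lambda>x. if x \<in> X then \<bar>f x\<bar> + 1 else 0)"
    have "positive_at X 0 g" "positive_at X 0 (f + g)"
      using f representatives_not_le_zero[OF X]
      by (auto simp: positive_at_def g_def function_space_def Idem_zero abs_if)
    moreover have "f = (f + g) - g" by simp
    ultimately show "f \<in> {f - g |f g. f \<in> positive_functions X \<and> g \<in> positive_functions X}"
      unfolding positive_functions_iff by blast
  qed (auto simp: positive_functions_def function_space_def)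
  obtain T :: 'a where T: "\<forall>x. x \<le> T" using cone_top_exists by blast
  show "positive_functions X \<inter> uminus ` positive_functions X = {0}"
  proof (intro set_eqI iffI)
    fix f assume "f \<in> positive_functions X \<inter> uminus ` positive_functions X"
    then obtain w v g where g: "positive_at X w f" "positive_at X v g" "f = - g"
      by (auto simp: positive_functions_iff)
    \<comment> \<open>The zero function is also positive at \<open>T\<close>, so uniqueness makes
      the meet, and with it \<open>w\<close>, the top; then \<open>f\<close> vanishes on all of
      \<open>X\<close>.\<close>
    have "positive_at X (inf w v) 0" using positive_at_add[OF g(1,2)] g(3) by simp
    then have "inf w v = T" using positive_at_unique[OF fg sc X] positive_at_zero[OF T] by blast
    then have "x \<le> w" for x using T by (metis le_inf_iff)
    then show "f \<in> {0}" using g(1) by (auto simp: positive_at_def function_space_def fun_eq_iff)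
  next
    fix f :: "'a \<Rightarrow> real" assume "f \<in> {0}"
    then have "f = 0" by simp
    moreover have "0 \<in> positive_functions X" using positive_at_zero[OF T] positive_functions_iff by blast
    moreover from this have "0 \<in> uminus ` positive_functions X" by (intro image_eqI[of _ _ 0]) auto
    ultimately show "f \<in> positive_functions X \<inter> uminus ` positive_functions X" by simp
  qed
qed

section \<open>Interpolation\<close>

text \<open>Solves the constraints on a single value of the interpolant: \<open>E\<close> holds the
  prescribed values, \<open>L\<close> and \<open>U\<close> the strict bounds. Finiteness leaves a
  gap between \<open>Max L\<close> and \<open>Min U\<close>.\<close>

lemma real_between_finite:
  fixes E L U :: "real set"
  assumes "finite L" "finite U" "\<And>e e'. e \<in> E \<Longrightarrow> e' \<in> E \<Longrightarrow> e = e'"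
    and "\<And>l e. l \<in> L \<Longrightarrow> e \<in> E \<Longrightarrow> l < e" "\<And>e u. e \<in> E \<Longrightarrow> u \<in> U \<Longrightarrow> e < u"
    and "\<And>l u. l \<in> L \<Longrightarrow> u \<in> U \<Longrightarrow> l < u"
  shows "\<exists>r. (\<forall>e\<in>E. r = e) \<and> (\<forall>l\<in>L. l < r) \<and> (\<forall>u\<in>U. r < u)"
proof (cases "E = {}")
  case True
  have "\<exists>r. (\<forall>l\<in>L. l < r) \<and> (\<forall>u\<in>U. r < u)"
  proof (cases "L = {} \<or> U = {}")
    case True
    have "\<exists>r. \<forall>l\<in>L. l < r" "\<exists>r. \<forall>u\<in>U. r < u"
      using assms(1,2) by (meson bdd_above_finite bdd_above.E gt_ex le_less_trans,
        meson bdd_below_finite bdd_below.E lt_ex less_le_trans)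
    with True show ?thesis by blast
  next
    case False
    then have "Max L < Min U" using assms by simp
    then obtain r where "Max L < r" "r < Min U" using dense by blast
    then show ?thesis using False assms(1,2) by auto
  qed
  with True show ?thesis by blast
next
  case False
  then obtain e where "e \<in> E" by blast
  with assms show ?thesis by (intro exI[of _ e]) auto
qed

lemma riesz_interpolation_positive_functions:
  fixes X :: "'a::extended_choquet_cone set"
  assumes fg: "finitely_generated TYPE('a)" and sc: "strongly_connected TYPE('a)"
    and X: "ray_representatives extreme_extensions X"
  shows "riesz_interpolation (function_space X) (positive_functions X)"
  unfolding riesz_interpolation_def Let_def
proof (intro allI impI, elim conjE)
  fix a b :: "nat \<Rightarrow> 'a \<Rightarrow> real"
  let ?I = "{1, 2 :: nat}"
  assume space: "\<forall>i\<in>?I. a i \<in> function_space X \<and> b i \<in> function_space X"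
    and "\<forall>i\<in>?I. \<forall>j\<in>?I. b j - a i \<in> positive_functions X"
  then have "\<exists>w. \<forall>i\<in>?I. \<forall>j\<in>?I. positive_at X (w i j) (b j - a i)"
    unfolding positive_functions_iff by metis
  then obtain w where pos: "\<And>i j. i \<in> ?I \<Longrightarrow> j \<in> ?I \<Longrightarrow> positive_at X (w i j) (b j - a i)"
    by blast
  then have idem: "w i j \<in> Idem" if "i \<in> ?I" "j \<in> ?I" for i j
    using that by (auto simp: positive_at_def)
  have crossing: "inf (w 1 1) (w 2 2) = inf (w 1 2) (w 2 1)"
  proof -
    have "(b 2 - a 1) + (b 1 - a 2) = (b 1 - a 1) + (b 2 - a 2)" by simp
    moreover have "positive_at X (inf (w 1 2) (w 2 1)) ((b 2 - a 1) + (b 1 - a 2))"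
      by (intro positive_at_add pos) auto
    moreover have "positive_at X (inf (w 1 1) (w 2 2)) ((b 1 - a 1) + (b 2 - a 2))"
      by (intro positive_at_add pos) auto
    ultimately show ?thesis using positive_at_unique[OF fg sc X] by metis
  qed
  define u where "u = (\<lambda>i. w i 1 + w i 2)"
  define v where "v = (\<lambda>j. w 1 j + w 2 j)"
  have uv_idem: "u i \<in> Idem" "v i \<in> Idem" if "i \<in> ?I" for i
    unfolding u_def v_def using that by (auto intro!: Idem_add idem)
  \<comment> \<open>Split \<open>e\<close> along \<open>p + q\<close>. The part below
    \<open>q\<close> is also below \<open>r\<close>, hence below \<open>p\<close>, and the
    idempotent \<open>p\<close> absorbs the sum.\<close>
  have transfer: "e \<le> p"
    if "e \<le> p + q" "e \<le> r" "inf r q \<le> p" "p \<in> Idem" for e p q r :: 'a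
  proof -
    have "e \<le> inf e p + inf e q" using that(1) by (rule le_add_inf)
    moreover have "inf e q \<le> p" using that(2,3) by (meson inf_mono order_refl order_trans)
    ultimately show ?thesis using that(4) by (meson Idem_add_le inf_le2 order_trans)
  qed
  \<comment> \<open>\<open>3 - j\<close> is the other index. For \<open>i \<noteq> k\<close> the
    entries \<open>w i j\<close> and \<open>w k (3 - j)\<close> are diagonally opposite, so by
    \<open>crossing\<close> their meet lies below \<open>w k j\<close>.\<close>
  have row: "e \<le> w k j" if "e \<le> w i j" "e \<le> u k" "i \<in> ?I" "j \<in> ?I" "k \<in> ?I" for e i j k
  proof (cases "i = k")
    case False
    then have "inf (w i j) (w k (3 - j)) \<le> w k j"
      using that(3-5) crossing by (auto simp: inf.commute) (metis inf.cobounded1 inf.cobounded2 inf.commute)+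
    moreover have "u k = w k j + w k (3 - j)"
      using that(4) by (auto simp: u_def add.commute)
    ultimately show ?thesis using transfer[of e "w k j" "w k (3 - j)" "w i j"] that idem by auto
  qed (use that in simp)
  have col: "e \<le> w i k" if "e \<le> w i j" "e \<le> v k" "i \<in> ?I" "j \<in> ?I" "k \<in> ?I" for e i j k
  proof (cases "j = k")
    case False
    then have "inf (w i j) (w (3 - i) k) \<le> w i k"
      using that(3-5) crossing by (auto simp: inf.commute) (metis inf.cobounded1 inf.cobounded2 inf.commute)+
    moreover have "v k = w i k + w (3 - i) k"
      using that(3) by (auto simp: v_def add.commute)
    ultimately show ?thesis using transfer[of e "w i k" "w (3 - i) k" "w i j"] that idem by auto
  qed (use that in simp)
  \<comment> \<open>By \<open>row\<close>, the meet of \<open>u i\<close> with the other entry of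
    column \<open>j\<close> is already below \<open>w i j\<close>; this is the input for
    \<open>transfer\<close>.\<close>
  have meet: "e \<le> w i j" if "e \<le> u i" "e \<le> v j" "i \<in> ?I" "j \<in> ?I" for e i j
  proof -
    have "inf (u i) (w (3 - i) j) \<le> w i j"
      by (rule row[of _ "3 - i"]) (use that(3,4) in auto)
    moreover have "v j = w i j + w (3 - i) j"
      using that(3) by (auto simp: v_def add.commute)
    ultimately show ?thesis using transfer[of e "w i j" "w (3 - i) j" "u i"] that idem by auto
  qed
  have "\<exists>r. (\<forall>i\<in>?I. (x \<le> u i \<longrightarrow> r = a i x) \<and> (x \<le> v i \<longrightarrow> r = b i x) \<and>
      (\<not> x \<le> u i \<longrightarrow> support_idem x \<le> u i \<longrightarrow> a i x < r) \<and>
      (\<not> x \<le> v i \<longrightarrow> support_idem x \<le> v i \<longrightarrow> r < b i x))" if x: "x \<in> X" for x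
  proof -
    let ?e = "support_idem x"
    have ex: "?e \<le> y" if "x \<le> y" for y using order_trans[OF support_idem_le that] .
    have eq: "a i x = b j x" if "x \<le> w i j" "i \<in> ?I" "j \<in> ?I" for i j
      using pos[OF that(2,3)] x that(1) by (auto simp: positive_at_def)
    have less: "a i x < b j x" if "?e \<le> w i j" "\<not> x \<le> w i j" "i \<in> ?I" "j \<in> ?I" for i j
      using pos[OF that(3,4)] x that(1,2) by (auto simp: positive_at_def)
    have "x \<in> extreme_extensions" using x X by (auto simp: ray_representatives_def)
    note prime = extreme_extension_prime[OF this]
    have prime_u: "\<exists>j\<in>?I. x \<le> w i j" if "x \<le> u i" "i \<in> ?I" for i
      using prime[of "w i 1" "w i 2"] that idem by (auto simp: u_def)
    have prime_v: "\<exists>i\<in>?I. x \<le> w i j" if "x \<le> v j" "j \<in> ?I" for j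
      using prime[of "w 1 j" "w 2 j"] that idem by (auto simp: v_def)
    have w_le: "w i j \<le> u i" "w i j \<le> v j" if "i \<in> ?I" "j \<in> ?I" for i j
      using that by (auto simp: u_def v_def)
    \<comment> \<open>Primeness puts \<open>x\<close> below some \<open>w i j\<close>, and
      \<open>row\<close> moves it below \<open>w k j\<close>. Both values then equal
      \<open>b j x\<close>.\<close>
    have aa: "a i x = a k x" if "x \<le> u i" "x \<le> u k" "i \<in> ?I" "k \<in> ?I" for i k
      using prime_u[OF that(1,3)] row eq that by metis
    have bb: "b i x = b k x" if "x \<le> v i" "x \<le> v k" "i \<in> ?I" "k \<in> ?I" for i k
      using prime_v[OF that(1,3)] col eq that by metis
    have ab: "a i x = b j x" if "x \<le> u i" "x \<le> v j" "i \<in> ?I" "j \<in> ?I" for i j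
      using meet eq that by metis
    \<comment> \<open>With \<open>x\<close> below \<open>w i j\<close>, \<open>a i x\<close> equals
      \<open>b j x\<close>. Applying \<open>row\<close> to the support idempotent instead of
      \<open>x\<close> gives \<open>a k x < b j x\<close>.\<close>
    have a_less: "a k x < a i x" if hyps: "x \<le> u i" "\<not> x \<le> u k" "?e \<le> u k" "i \<in> ?I" "k \<in> ?I" for i k
    proof -
      obtain j where j: "j \<in> ?I" "x \<le> w i j" using prime_u[OF hyps(1,4)] by blast
      have "?e \<le> w k j" by (rule row[OF ex[OF j(2)] hyps(3,4) j(1) hyps(5)])
      moreover have "\<not> x \<le> w k j" using hyps(2) order_trans[OF _ w_le(1)[OF hyps(5) j(1)]] by blast
      ultimately show ?thesis using less[OF _ _ hyps(5) j(1)] eq[OF j(2) hyps(4) j(1)] by simp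
    qed
    have b_less: "b i x < b k x" if hyps: "x \<le> v i" "\<not> x \<le> v k" "?e \<le> v k" "i \<in> ?I" "k \<in> ?I" for i k
    proof -
      obtain j where j: "j \<in> ?I" "x \<le> w j i" using prime_v[OF hyps(1,4)] by blast
      have "?e \<le> w j k" by (rule col[OF ex[OF j(2)] hyps(3) j(1) hyps(4,5)])
      moreover have "\<not> x \<le> w j k" using hyps(2) order_trans[OF _ w_le(2)[OF j(1) hyps(5)]] by blast
      ultimately show ?thesis using less[OF _ _ j(1) hyps(5)] eq[OF j(2) j(1) hyps(4)] by simp
    qed
    have ab_less: "a i x < b j x"
      if "?e \<le> u i" "?e \<le> v j" "\<not> x \<le> u i \<or> \<not> x \<le> v j" "i \<in> ?I" "j \<in> ?I" for i j
    proof (rule less)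
      show "?e \<le> w i j" using meet that by blast
      show "\<not> x \<le> w i j"
        using order_trans[OF _ w_le(1)[OF that(4,5)]] order_trans[OF _ w_le(2)[OF that(4,5)]] that(3)
        by blast
    qed (use that in auto)
    \<comment> \<open>Values are forced where \<open>x\<close> lies below \<open>u i\<close> or
      \<open>v i\<close>; where only its support idempotent does, a strict bound arises.\<close>
    let ?E = "{a i x | i. i \<in> ?I \<and> x \<le> u i} \<union> {b i x | i. i \<in> ?I \<and> x \<le> v i}"
    let ?L = "{a i x | i. i \<in> ?I \<and> \<not> x \<le> u i \<and> ?e \<le> u i}"
    let ?U = "{b i x | i. i \<in> ?I \<and> \<not> x \<le> v i \<and> ?e \<le> v i}"
    have "\<exists>r. (\<forall>e\<in>?E. r = e) \<and> (\<forall>l\<in>?L. l < r) \<and> (\<forall>u\<in>?U. r < u)"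
    proof (rule real_between_finite)
      fix e e' assume "e \<in> ?E" "e' \<in> ?E"
      then show "e = e'" using aa bb ab by (elim UnE CollectE exE conjE) metis+
    next
      fix l e assume "l \<in> ?L" "e \<in> ?E"
      then show "l < e" using a_less ab_less ex by (elim UnE CollectE exE conjE) metis+
    next
      fix e u assume "e \<in> ?E" "u \<in> ?U"
      then show "e < u" using b_less ab_less ex by (elim UnE CollectE exE conjE) metis+
    next
      fix l u assume "l \<in> ?L" "u \<in> ?U"
      then show "l < u" using ab_less by (elim CollectE exE conjE) metis
    qed simp_all
    then obtain r where r: "\<forall>e\<in>?E. r = e" "\<forall>l\<in>?L. l < r" "\<forall>u\<in>?U. r < u"
      by (elim exE conjE)
    show ?thesis
    proof (intro exI[of _ r] ballI conjI impI)
      fix i assume i: "i \<in> ?I"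
      show "r = a i x" if "x \<le> u i" by (rule bspec[OF r(1)]) (use i that in blast)
      show "r = b i x" if "x \<le> v i" by (rule bspec[OF r(1)]) (use i that in blast)
      show "a i x < r" if "\<not> x \<le> u i" "?e \<le> u i" by (rule bspec[OF r(2)]) (use i that in blast)
      show "r < b i x" if "\<not> x \<le> v i" "?e \<le> v i" by (rule bspec[OF r(3)]) (use i that in blast)
    qed
  qed
  then obtain r where r: "\<And>x i. x \<in> X \<Longrightarrow> i \<in> ?I \<Longrightarrow>
      (x \<le> u i \<longrightarrow> r x = a i x) \<and> (x \<le> v i \<longrightarrow> r x = b i x) \<and>
      (\<not> x \<le> u i \<longrightarrow> support_idem x \<le> u i \<longrightarrow> a i x < r x) \<and>
      (\<not> x \<le> v i \<longrightarrow> support_idem x \<le> v i \<longrightarrow> r x < b i x)"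
    by metis
  define c where "c = (\<lambda>x. if x \<in> X then r x else 0)"
  have c: "c \<in> function_space X" by (simp add: c_def function_space_def)
  have "positive_at X (u i) (c - a i)" "positive_at X (v i) (b i - c)" if "i \<in> ?I" for i
    using r[OF _ that] that space uv_idem[OF that] c
    by (auto simp: positive_at_def c_def function_space_def)
  with c show "\<exists>c\<in>function_space X. \<forall>i\<in>?I. \<forall>j\<in>?I.
      c - a i \<in> positive_functions X \<and> b j - c \<in> positive_functions X"
    unfolding positive_functions_iff by blast
qed

theorem theorem7p8:
  fixes X :: "'a::extended_choquet_cone set"
  assumes "finitely_generated TYPE('a)"
    and "strongly_connected TYPE('a)"
    and "ray_representatives extreme_extensions X"
  shows "ordered_vector_space (function_space X) (positive_functions X)
    \<and> riesz_interpolation (function_space X) (positive_functions X)"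
  using ordered_vector_space_positive_functions[OF assms]
    riesz_interpolation_positive_functions[OF assms] by blast

end
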